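(* Every sofic system has a bi-instantaneous presentation; that is, every sofic subshift is topologically conjugate to a bi-instantaneous subshift.
   Context: A subshift $X\subset\Sigma^{\mathbb Z}$ ($\Sigma$ finite, every symbol of $\Sigma$ occurring in $X$) is a closed shift-invariant set; a presentation of $X$ is any subshift topologically conjugate to $X$. $X$ is right instantaneous if for every symbol $\sigma\in\Sigma$ there is a symbol $\tau$ such that $x^-\sigma\tau$ is admissible for $X$ for every left-infinite word $x^-$ such that $x^-\sigma$ is admissible (where a left-infinite word is admissible if it is carried by $x_{(-\infty,0]}$ for some $x\in X$). Left instantaneity is defined time-symmetrically. $X$ is bi-instantaneous if it is both left and right instantaneous. *)

theory Defs
  imports "HOL-Analysis.Analysis"
begin

definition shift :: "(int \<Rightarrow> 'a) \<Rightarrow> int \<Rightarrow> 'a" where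
  "shift x = (\<lambda>i. x (i + 1))"

definition full_shift :: "'a set \<Rightarrow> (int \<Rightarrow> 'a) topology" where
  "full_shift A = product_topology (\<lambda>_. discrete_topology A) UNIV"

text \<open>The alphabet of a subshift is exactly the set of symbols that occur in its points.
  The empty subshift (over the empty alphabet) is allowed.\<close>

definition subshift :: "'a set \<Rightarrow> (int \<Rightarrow> 'a) set \<Rightarrow> bool" where
  "subshift A X \<longleftrightarrow>
     finite A \<and> closedin (full_shift A) X \<and> shift ` X = X \<and> (\<Union>x\<in>X. range x) = A"

definition conjugacy ::
    "'a set \<Rightarrow> (int \<Rightarrow> 'a) set \<Rightarrow> 'b set \<Rightarrow> (int \<Rightarrow> 'b) set \<Rightarrow> ((int \<Rightarrow> 'a) \<Rightarrow> int \<Rightarrow> 'b) \<Rightarrow> bool" where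
  "conjugacy A X B Y \<phi> \<longleftrightarrow>
     homeomorphic_map (subtopology (full_shift A) X) (subtopology (full_shift B) Y) \<phi> \<and>
     (\<forall>x\<in>X. \<phi> (shift x) = shift (\<phi> x))"

definition topologically_conjugate ::
    "'a set \<Rightarrow> (int \<Rightarrow> 'a) set \<Rightarrow> 'b set \<Rightarrow> (int \<Rightarrow> 'b) set \<Rightarrow> bool" where
  "topologically_conjugate A X B Y \<longleftrightarrow> (\<exists>\<phi>. conjugacy A X B Y \<phi>)"

text \<open>A sofic system is the set of label sequences of the bi-infinite paths in a finite
  labelled directed graph. The graph is given by its set of edges (source, label, target);
  taking natural numbers as vertices is no restriction, since the graph is finite.\<close>

definition sofic :: "(int \<Rightarrow> 'a) set \<Rightarrow> bool" where
  "sofic X \<longleftrightarrow> (\<exists>E :: (nat \<times> 'a \<times> nat) set. finite E \<and>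
     X = {x. \<exists>v. \<forall>i. (v i, x i, v (i + 1)) \<in> E})"

text \<open>One-sided infinite words are functions on the natural numbers, indexed by the distance
  from the finite end. So a left-infinite word \<open>w\<close> is read as \<open>\<dots> w 2, w 1, w 0\<close>, and
  \<open>case_nat \<sigma> w\<close> is \<open>w\<close> with \<open>\<sigma>\<close> appended at its right end; for a right-infinite word it is
  \<open>w\<close> with \<open>\<sigma>\<close> prepended at its left end.\<close>

definition admissible_left_infinite :: "(int \<Rightarrow> 'a) set \<Rightarrow> (nat \<Rightarrow> 'a) \<Rightarrow> bool" where
  "admissible_left_infinite X w \<longleftrightarrow> (\<exists>x\<in>X. \<forall>n. w n = x (- int n))"

definition admissible_right_infinite :: "(int \<Rightarrow> 'a) set \<Rightarrow> (nat \<Rightarrow> 'a) \<Rightarrow> bool" where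
  "admissible_right_infinite X w \<longleftrightarrow> (\<exists>x\<in>X. \<forall>n. w n = x (int n))"

definition right_instantaneous :: "'a set \<Rightarrow> (int \<Rightarrow> 'a) set \<Rightarrow> bool" where
  "right_instantaneous A X \<longleftrightarrow> (\<forall>\<sigma>\<in>A. \<exists>\<tau>\<in>A. \<forall>w.
     admissible_left_infinite X (case_nat \<sigma> w) \<longrightarrow>
     admissible_left_infinite X (case_nat \<tau> (case_nat \<sigma> w)))"

definition left_instantaneous :: "'a set \<Rightarrow> (int \<Rightarrow> 'a) set \<Rightarrow> bool" where
  "left_instantaneous A X \<longleftrightarrow> (\<forall>\<sigma>\<in>A. \<exists>\<tau>\<in>A. \<forall>w.
     admissible_right_infinite X (case_nat \<sigma> w) \<longrightarrow>
     admissible_right_infinite X (case_nat \<tau> (case_nat \<sigma> w)))"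

definition bi_instantaneous :: "'a set \<Rightarrow> (int \<Rightarrow> 'a) set \<Rightarrow> bool" where
  "bi_instantaneous A X \<longleftrightarrow> left_instantaneous A X \<and> right_instantaneous A X"

end

theory Submission
  imports Defs
begin

text \<open>
  Call a position \<open>c\<close> of a point \<open>x\<close> right-safe if the last few letters of \<open>x\<close> up to \<open>c\<close> already
  determine some continuation that is admissible after every left-infinite word ending in these
  letters, and call it left-safe in the time-symmetric situation. In a sofic system every long
  word contains a right-safe position: among the transition relations (on the vertices of the
  graph) of its prefixes two must coincide, say those of \<open>u\<close> and \<open>u w\<close>. Then \<open>w\<close> can be inserted
  after \<open>u\<close> any number of times, whatever precedes \<open>u\<close>
  (\<open>insert_after_in_sofic\<close>, \<open>right_syndetic_sofic\<close>).

  The new symbol of \<open>x\<close> at \<open>i\<close> displays \<open>x\<close> on a window \<open>[b, c]\<close> around \<open>i\<close> of variable length, where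
  \<open>c\<close> is the first right-safe position at distance at least \<open>n\<close> to the right of \<open>i\<close>, and \<open>b\<close> the
  first left-safe position at distance at least \<open>n\<close> to the left of \<open>i\<close>. Safety of a position
  is visible in the letters at distance at most \<open>n\<close> before it (right) or after it (left). The margin \<open>n\<close>
  therefore makes the displayed letters alone certify that the window is the correct one
  (\<open>view_cong\<close>): nothing outside \<open>[b, c]\<close> is betrayed by the symbol.

  This gives right instantaneity (\<open>view_successor\<close>). As \<open>c\<close> is right-safe, there is a word that
  can be appended to the past up to \<open>c\<close> of all points showing a given symbol. Doing so leaves
  their symbols up to \<open>i\<close> unchanged, because these display nothing to the right of \<open>c\<close>, and it
  gives the same next symbol to all of them, because the next window lies in the part on which
  they now agree. Left instantaneity is the same statement for the reflected system. Finally
  the recoding is an injective sliding block code, hence a conjugacy onto its image.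
\<close>

section \<open>Safe positions and the windows between them\<close>

text \<open>The number \<open>n\<close> bounds both the memory \<open>x\<^sub>c\<^sub>-\<^sub>n, \<dots>, x\<^sub>c\<close> and the continuation \<open>z\<close>. The
  continuation has \<open>n + 1\<close> letters since a window for position \<open>i + 1\<close> ends by \<open>i + 1 + 2 n\<close>,
  while one for \<open>i\<close> ends at some \<open>c \<ge> i + n\<close>. Asking only for finitely many letters avoids a
  compactness argument.\<close>

definition right_safe :: "(int \<Rightarrow> 'a) set \<Rightarrow> nat \<Rightarrow> (int \<Rightarrow> 'a) \<Rightarrow> int \<Rightarrow> bool" where
  "right_safe X n x c \<longleftrightarrow> (\<exists>z. \<forall>y\<in>X. (\<forall>k\<in>{c - int n..c}. y k = x k) \<longrightarrow>
     (\<exists>y'\<in>X. (\<forall>k\<le>c. y' k = y k) \<and> (\<forall>k\<in>{c<..c + int n + 1}. y' k = z k)))"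

definition reflection :: "(int \<Rightarrow> 'a) \<Rightarrow> int \<Rightarrow> 'a" where
  "reflection x = (\<lambda>i. x (- i))"

definition right_end :: "(int \<Rightarrow> 'a) set \<Rightarrow> nat \<Rightarrow> (int \<Rightarrow> 'a) \<Rightarrow> int \<Rightarrow> int" where
  "right_end X n x i = i + int n + int (LEAST d. right_safe X n x (i + int n + int d))"

definition left_end :: "(int \<Rightarrow> 'a) set \<Rightarrow> nat \<Rightarrow> (int \<Rightarrow> 'a) \<Rightarrow> int \<Rightarrow> int" where
  "left_end X n x i = - right_end (reflection ` X) n (reflection x) (- i)"

text \<open>The displayed word is stored relative to \<open>i\<close>, as a partial function of the offset \<open>k\<close>, so
  that shifting a point shifts its sequence of views.\<close>

definition view :: "(int \<Rightarrow> 'a) set \<Rightarrow> nat \<Rightarrow> (int \<Rightarrow> 'a) \<Rightarrow> int \<Rightarrow> int \<Rightarrow> 'a option" where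
  "view X n x i =
     (\<lambda>k. if i + k \<in> {left_end X n x i..right_end X n x i} then Some (x (i + k)) else None)"

lemma reflection_reflection [simp]: "reflection (reflection x) = x"
  by (simp add: reflection_def)

lemma reflection_image_image [simp]: "reflection ` reflection ` X = X"
  by (simp add: image_image)

lemma right_safe_cong:
  assumes "\<forall>k\<in>{c - int n..c}. y k = x k"
  shows "right_safe X n y c \<longleftrightarrow> right_safe X n x c"
proof -
  have "(\<forall>k\<in>{c - int n..c}. u k = y k) \<longleftrightarrow> (\<forall>k\<in>{c - int n..c}. u k = x k)" for u
    using assms by auto
  then show ?thesis
    unfolding right_safe_def by simp
qed

locale safely_syndetic =
  fixes X :: "(int \<Rightarrow> 'a) set" and n :: nat
  assumes translate: "\<And>x k. x \<in> X \<Longrightarrow> (\<lambda>i. x (i + k)) \<in> X"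
    and right_syndetic: "\<And>x i. x \<in> X \<Longrightarrow> \<exists>c\<in>{i..i + int n}. right_safe X n x c"
    and left_syndetic:
      "\<And>x i. x \<in> X \<Longrightarrow> \<exists>c\<in>{i..i + int n}. right_safe (reflection ` X) n (reflection x) c"
begin

text \<open>The assumptions are symmetric under reflection, so every fact about right ends yields
  the corresponding one about left ends.\<close>

lemma reflected: "safely_syndetic (reflection ` X) n"
proof
  fix x k assume "x \<in> reflection ` X"
  then obtain y where y: "y \<in> X" "x = reflection y" by blast
  then have "(\<lambda>i. x (i + k)) = reflection (\<lambda>i. y (i + (- k)))"
    by (simp add: reflection_def fun_eq_iff)
  with translate[OF y(1)] show "(\<lambda>i. x (i + k)) \<in> reflection ` X" by blast
qed (use left_syndetic right_syndetic in auto)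

lemma right_end_safe:
  assumes "x \<in> X"
  shows "right_safe X n x (right_end X n x i)"
    and "i + int n \<le> right_end X n x i"
    and "right_end X n x i \<le> i + 2 * int n"
proof -
  obtain c where c: "c \<in> {i + int n..i + int n + int n}" "right_safe X n x c"
    using right_syndetic[OF assms] by blast
  define d where "d = nat (c - (i + int n))"
  have d: "right_safe X n x (i + int n + int d)" "d \<le> n"
    using c by (auto simp: d_def)
  show "right_safe X n x (right_end X n x i)"
    unfolding right_end_def by (rule LeastI) (rule d)
  show "i + int n \<le> right_end X n x i"
    by (simp add: right_end_def)
  show "right_end X n x i \<le> i + 2 * int n"
    using Least_le[of "\<lambda>d. right_safe X n x (i + int n + int d)", OF d(1)] d(2)
    by (simp add: right_end_def)
qed

lemma right_end_le:
  assumes "right_safe X n x c" "i + int n \<le> c"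
  shows "right_end X n x i \<le> c"
proof -
  have "right_safe X n x (i + int n + int (nat (c - (i + int n))))"
    using assms by simp
  from Least_le[of "\<lambda>d. right_safe X n x (i + int n + int d)", OF this] assms(2)
  show ?thesis by (simp add: right_end_def)
qed

lemma right_end_mono:
  assumes "x \<in> X" "i \<le> j"
  shows "right_end X n x i \<le> right_end X n x j"
  using right_end_le[OF right_end_safe(1)[OF assms(1)], of i j] right_end_safe(2)[OF assms(1), of j] assms(2)
  by linarith

text \<open>Every candidate for the right end is at least \<open>i + n\<close>, so its safety is decided by letters at
  positions from \<open>i\<close> on. Agreement up to the first safe position thus suffices.\<close>

lemma right_end_cong:
  assumes x: "x \<in> X" and y: "y \<in> X" and eq: "\<forall>k\<in>{i..right_end X n x i}. y k = x k"
  shows "right_end X n y i = right_end X n x i"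
proof -
  have iff: "right_safe X n y c \<longleftrightarrow> right_safe X n x c"
    if "i + int n \<le> c" "c \<le> right_end X n x i" for c
    using that eq by (intro right_safe_cong) auto
  have le: "right_end X n y i \<le> right_end X n x i"
    using iff right_end_safe[OF x, of i] by (intro right_end_le) auto
  then have "right_safe X n x (right_end X n y i)"
    using iff right_end_safe[OF y, of i] by auto
  then have "right_end X n x i \<le> right_end X n y i"
    using right_end_safe(2)[OF y, of i] by (intro right_end_le)
  with le show ?thesis by simp
qed

lemma left_end_bounds:
  assumes "x \<in> X"
  shows "left_end X n x i \<le> i - int n" "i - 2 * int n \<le> left_end X n x i"
  using safely_syndetic.right_end_safe(2,3)[OF reflected, of "reflection x" "- i"] assms
  by (auto simp: left_end_def)

lemma left_end_mono:
  assumes "x \<in> X" "i \<le> j"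
  shows "left_end X n x i \<le> left_end X n x j"
  using safely_syndetic.right_end_mono[OF reflected, of "reflection x" "- j" "- i"] assms
  by (auto simp: left_end_def)

lemma left_end_cong:
  assumes "x \<in> X" "y \<in> X" and "\<forall>k\<in>{left_end X n x i..i}. y k = x k"
  shows "left_end X n y i = left_end X n x i"
proof -
  have "right_end (reflection ` X) n (reflection y) (- i)
      = right_end (reflection ` X) n (reflection x) (- i)"
    using assms
    by (intro safely_syndetic.right_end_cong[OF reflected]) (auto simp: left_end_def reflection_def)
  then show ?thesis by (simp add: left_end_def)
qed

lemma right_safe_translate:
  assumes "right_safe X n x (c + k)"
  shows "right_safe X n (\<lambda>i. x (i + k)) c"
proof -
  obtain z where z: "\<And>y. y \<in> X \<Longrightarrow> (\<forall>j\<in>{c + k - int n..c + k}. y j = x j) \<Longrightarrow>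
     (\<exists>y'\<in>X. (\<forall>j\<le>c + k. y' j = y j) \<and> (\<forall>j\<in>{c + k<..c + k + int n + 1}. y' j = z j))"
    using assms unfolding right_safe_def by blast
  show ?thesis
    unfolding right_safe_def
  proof (intro exI[of _ "\<lambda>i. z (i + k)"] ballI impI)
    fix y assume y: "y \<in> X" and eq: "\<forall>j\<in>{c - int n..c}. y j = x (j + k)"
    have "\<forall>j\<in>{c + k - int n..c + k}. y (j + (- k)) = x j"
    proof
      fix j assume "j \<in> {c + k - int n..c + k}"
      with eq[rule_format, of "j - k"] show "y (j + (- k)) = x j" by simp
    qed
    from z[OF translate[OF y, of "- k"] this] obtain y' where y': "y' \<in> X"
      "\<forall>j\<le>c + k. y' j = y (j + (- k))" "\<forall>j\<in>{c + k<..c + k + int n + 1}. y' j = z j" by blast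
    show "\<exists>y'\<in>X. (\<forall>j\<le>c. y' j = y j) \<and> (\<forall>j\<in>{c<..c + int n + 1}. y' j = z (j + k))"
      using y'(2,3) by (intro bexI[OF _ translate[OF y'(1), of k]]) auto
  qed
qed

lemma right_safe_translate_iff:
  "right_safe X n (\<lambda>i. x (i + k)) c \<longleftrightarrow> right_safe X n x (c + k)"
  using right_safe_translate[of x c k] right_safe_translate[of "\<lambda>i. x (i + k)" "c + k" "- k"]
  by auto

lemma right_end_translate:
  "right_end X n (\<lambda>i. x (i + k)) j = right_end X n x (j + k) - k"
  by (simp add: right_end_def right_safe_translate_iff algebra_simps)

lemma left_end_translate:
  "left_end X n (\<lambda>i. x (i + k)) j = left_end X n x (j + k) - k"
proof -
  have "reflection (\<lambda>i. x (i + k)) = (\<lambda>i. reflection x (i + (- k)))"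
    by (simp add: reflection_def)
  then show ?thesis
    by (simp only: left_end_def safely_syndetic.right_end_translate[OF reflected]) simp
qed

lemma view_translate: "view X n (\<lambda>i. x (i + k)) j = view X n x (j + k)"
  by (auto simp: view_def right_end_translate left_end_translate algebra_simps fun_eq_iff)

lemma view_reflection:
  "view (reflection ` X) n (reflection x) (- i) = (\<lambda>k. view X n x i (- k))"
  by (auto simp: view_def left_end_def reflection_def[of x, THEN fun_cong] fun_eq_iff)

text \<open>A view reveals nothing but the letters that it displays: the letters deciding its right end
  lie between \<open>i\<close> and that end, and those deciding its left end lie between that end and \<open>i\<close>.\<close>

lemma view_cong:
  assumes "x \<in> X" "y \<in> X" "\<forall>k\<in>{left_end X n x i..right_end X n x i}. y k = x k"
  shows "view X n y i = view X n x i"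
proof -
  have "right_end X n y i = right_end X n x i"
    using assms left_end_bounds(1)[OF assms(1), of i] by (intro right_end_cong) auto
  moreover have "left_end X n y i = left_end X n x i"
    using assms right_end_safe(2)[OF assms(1), of i] by (intro left_end_cong) auto
  ultimately show ?thesis
    using assms(3) by (auto simp: view_def fun_eq_iff)
qed

lemma view_eqD:
  assumes "x \<in> X" "y \<in> X" "view X n y i = view X n x i"
  shows "left_end X n y i = left_end X n x i" "right_end X n y i = right_end X n x i"
    and "\<forall>k\<in>{left_end X n x i..right_end X n x i}. y k = x k"
proof -
  have iff: "k \<in> {left_end X n y i..right_end X n y i} \<longleftrightarrow> k \<in> {left_end X n x i..right_end X n x i}"
    for k using fun_cong[OF assms(3), of "k - i"] by (auto simp: view_def split: if_splits)
  have "{left_end X n y i..right_end X n y i} = {left_end X n x i..right_end X n x i}"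
    using iff by blast
  moreover have "left_end X n x i \<le> right_end X n x i"
    using left_end_bounds(1)[OF assms(1), of i] right_end_safe(2)[OF assms(1), of i] by linarith
  ultimately show "left_end X n y i = left_end X n x i" "right_end X n y i = right_end X n x i"
    by (auto simp: Icc_eq_Icc)
  show "\<forall>k\<in>{left_end X n x i..right_end X n x i}. y k = x k"
  proof
    fix k assume "k \<in> {left_end X n x i..right_end X n x i}"
    with iff[of k] fun_cong[OF assms(3), of "k - i"] show "y k = x k"
      by (auto simp: view_def)
  qed
qed

lemma view_0:
  assumes "x \<in> X"
  shows "view X n x i 0 = Some (x i)"
  using left_end_bounds(1)[OF assms, of i] right_end_safe(2)[OF assms, of i] by (simp add: view_def)

lemma finite_views:
  assumes "finite A" "\<And>x i. x \<in> X \<Longrightarrow> x i \<in> A"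
  shows "finite {view X n x i | x i. x \<in> X}"
proof (rule finite_subset)
  let ?I = "{- 2 * int n..2 * int n}"
  show "{view X n x i | x i. x \<in> X} \<subseteq> {f. \<forall>k. (k \<in> ?I \<longrightarrow> f k \<in> insert None (Some ` A)) \<and>
      (k \<notin> ?I \<longrightarrow> f k = None)}"
  proof clarify
    fix x i k assume x: "x \<in> X"
    show "(k \<in> ?I \<longrightarrow> view X n x i k \<in> insert None (Some ` A)) \<and>
        (k \<notin> ?I \<longrightarrow> view X n x i k = None)"
      using left_end_bounds(2)[OF x, of i] right_end_safe(3)[OF x, of i] assms(2)[OF x]
      by (auto simp: view_def)
  qed
  show "finite {f. \<forall>k. (k \<in> ?I \<longrightarrow> f k \<in> insert None (Some ` A)) \<and> (k \<notin> ?I \<longrightarrow> f k = None)}"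
    using assms(1) by (intro finite_set_of_finite_funs) auto
qed

section \<open>The sequence of views is bi-instantaneous\<close>

text \<open>The heart of right instantaneity: the view of \<open>x1\<close> at \<open>1\<close> can follow the view of \<open>x0\<close> at \<open>0\<close>
  after every past. Both \<open>x1\<close> and the point \<open>x2\<close> built from an arbitrary \<open>x\<close> showing the same view
  as \<open>x0\<close> carry the continuation \<open>z\<close> provided by the safe right end of that view. They agree from the
  left end of the view up to the end of \<open>z\<close>, and the window for position \<open>1\<close> lies in
  between.\<close>

lemma view_successor:
  assumes "x0 \<in> X"
  obtains x1 where "x1 \<in> X"
    "\<And>x. x \<in> X \<Longrightarrow> view X n x 0 = view X n x0 0 \<Longrightarrow>
      \<exists>x2\<in>X. view X n x2 1 = view X n x1 1 \<and> (\<forall>j\<le>0. view X n x2 j = view X n x j)"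
proof -
  define b c where "b = left_end X n x0 0" and "c = right_end X n x0 0"
  have bc: "b \<le> - int n" "int n \<le> c"
    using left_end_bounds(1)[OF assms, of 0] right_end_safe(2)[OF assms, of 0]
    by (simp_all add: b_def c_def)
  obtain z where z: "\<And>y. y \<in> X \<Longrightarrow> (\<forall>k\<in>{c - int n..c}. y k = x0 k) \<Longrightarrow>
     (\<exists>y'\<in>X. (\<forall>k\<le>c. y' k = y k) \<and> (\<forall>k\<in>{c<..c + int n + 1}. y' k = z k))"
    using right_end_safe(1)[OF assms, of 0] unfolding right_safe_def c_def by blast
  obtain x1 where x1: "x1 \<in> X" "\<forall>k\<le>c. x1 k = x0 k" "\<forall>k\<in>{c<..c + int n + 1}. x1 k = z k"
    using z[OF assms] by blast
  have "view X n x1 0 = view X n x0 0"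
    using x1 assms by (intro view_cong) (auto simp: c_def)
  then have b1: "b \<le> left_end X n x1 1"
    using view_eqD(1)[OF assms x1(1)] left_end_mono[OF x1(1), of 0 1] by (simp add: b_def)
  have c1: "right_end X n x1 1 \<le> c + int n + 1"
    using right_end_safe(3)[OF x1(1), of 1] bc by simp
  show ?thesis
  proof (rule that[OF x1(1)])
    fix x assume x: "x \<in> X" and v: "view X n x 0 = view X n x0 0"
    have eq: "\<forall>k\<in>{b..c}. x k = x0 k" and c: "right_end X n x 0 = c"
      using view_eqD[OF assms x v] by (simp_all add: b_def c_def)
    obtain x2 where x2: "x2 \<in> X" "\<forall>k\<le>c. x2 k = x k" "\<forall>k\<in>{c<..c + int n + 1}. x2 k = z k"
      using z[OF x] eq bc by auto
    have "\<forall>k\<in>{b..c + int n + 1}. x2 k = x1 k"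
    proof
      fix k assume "k \<in> {b..c + int n + 1}"
      with x1 x2 eq show "x2 k = x1 k" by (cases "k \<le> c") auto
    qed
    then have "view X n x2 1 = view X n x1 1"
      using b1 c1 x1 x2 by (intro view_cong) auto
    moreover have "view X n x2 j = view X n x j" if "j \<le> 0" for j
      using right_end_mono[OF x that] x x2 c by (intro view_cong) auto
    ultimately show "\<exists>x2\<in>X. view X n x2 1 = view X n x1 1 \<and> (\<forall>j\<le>0. view X n x2 j = view X n x j)"
      using x2(1) by blast
  qed
qed

lemma right_instantaneous_views:
  assumes inj: "inj_on enc {view X n x i | x i. x \<in> X}"
  shows "right_instantaneous (\<Union>x\<in>X. range (\<lambda>i. enc (view X n x i)))
           ((\<lambda>x i. enc (view X n x i)) ` X)"
  unfolding right_instantaneous_def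
proof
  fix \<sigma> assume "\<sigma> \<in> (\<Union>x\<in>X. range (\<lambda>i. enc (view X n x i)))"
  then obtain x i where "x \<in> X" "\<sigma> = enc (view X n x i)" by blast
  then obtain x0 where x0: "x0 \<in> X" "\<sigma> = enc (view X n x0 0)"
    using translate[of x i] view_translate[of x i 0] by auto
  obtain x1 where x1: "x1 \<in> X" and step:
    "\<And>x. x \<in> X \<Longrightarrow> view X n x 0 = view X n x0 0 \<Longrightarrow>
      \<exists>x2\<in>X. view X n x2 1 = view X n x1 1 \<and> (\<forall>j\<le>0. view X n x2 j = view X n x j)"
    by (rule view_successor[OF x0(1)]) blast
  let ?\<phi> = "\<lambda>x i. enc (view X n x i)"
  let ?\<tau> = "?\<phi> x1 1"
  show "\<exists>\<tau>\<in>\<Union>x\<in>X. range (?\<phi> x). \<forall>w.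
      admissible_left_infinite (?\<phi> ` X) (case_nat \<sigma> w) \<longrightarrow>
      admissible_left_infinite (?\<phi> ` X) (case_nat \<tau> (case_nat \<sigma> w))"
  proof (intro bexI[of _ ?\<tau>] allI impI)
    show "?\<tau> \<in> (\<Union>x\<in>X. range (?\<phi> x))" using x1 by blast
    fix w assume "admissible_left_infinite (?\<phi> ` X) (case_nat \<sigma> w)"
    then obtain x where x: "x \<in> X" and w: "\<And>m. case_nat \<sigma> w m = ?\<phi> x (- int m)"
      unfolding admissible_left_infinite_def by blast
    have "?\<phi> x 0 = ?\<phi> x0 0" using w[of 0] x0 by simp
    then have "view X n x 0 = view X n x0 0"
      using x x0(1) by (intro inj_onD[OF inj]) auto
    then obtain x2 where x2: "x2 \<in> X" "view X n x2 1 = view X n x1 1"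
      "\<forall>j\<le>0. view X n x2 j = view X n x j"
      using step[OF x] by blast
    have "case_nat ?\<tau> (case_nat \<sigma> w) m = ?\<phi> (\<lambda>i. x2 (i + 1)) (- int m)" for m
      using x2 by (cases m) (simp_all add: view_translate w)
    then show "admissible_left_infinite (?\<phi> ` X) (case_nat ?\<tau> (case_nat \<sigma> w))"
      unfolding admissible_left_infinite_def
      by (intro bexI[OF _ imageI[OF translate[OF x2(1), of 1]]] allI)
  qed
qed

end

lemma left_instantaneous_reflection:
  assumes "right_instantaneous B (reflection ` Y)"
  shows "left_instantaneous B Y"
proof -
  have "admissible_right_infinite Y w \<longleftrightarrow> admissible_left_infinite (reflection ` Y) w" for w
    by (auto simp: admissible_right_infinite_def admissible_left_infinite_def reflection_def)
  with assms show ?thesis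
    by (simp add: left_instantaneous_def right_instantaneous_def)
qed

text \<open>The encoding \<open>enc\<close> of views as symbols is arbitrary, because a view of the reflected system
  is the reversal of a view of \<open>X\<close>: precomposing \<open>enc\<close> with reversal codes the reflected system by the
  same symbols.\<close>

lemma (in safely_syndetic) bi_instantaneous_views:
  assumes inj: "inj_on enc {view X n x i | x i. x \<in> X}"
  shows "bi_instantaneous (\<Union>x\<in>X. range (\<lambda>i. enc (view X n x i)))
           ((\<lambda>x i. enc (view X n x i)) ` X)"
proof -
  let ?X = "reflection ` X"
  define enc' where "enc' f = enc (\<lambda>k. f (- k))" for f
  have enc': "enc' (view ?X n (reflection x) i) = enc (view X n x (- i))" for x i
    using view_reflection[of x "- i"] by (simp add: enc'_def)
  have "inj_on enc' {view ?X n x i | x i. x \<in> ?X}"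
  proof (rule inj_onI, clarify)
    fix x i y j assume *: "x \<in> X" "y \<in> X"
      "enc' (view ?X n (reflection x) i) = enc' (view ?X n (reflection y) j)"
    have "view X n x (- i) = view X n y (- j)"
      using * by (intro inj_onD[OF inj]) (auto simp: enc')
    then show "view ?X n (reflection x) i = view ?X n (reflection y) j"
      using view_reflection[of x "- i"] view_reflection[of y "- j"] by simp
  qed
  from safely_syndetic.right_instantaneous_views[OF reflected this]
  have "right_instantaneous (\<Union>x\<in>X. range (\<lambda>i. enc (view X n x (- i))))
      ((\<lambda>x i. enc (view X n x (- i))) ` X)"
    by (simp add: image_image enc')
  moreover have "range (\<lambda>i. enc (view X n x (- i))) = range (\<lambda>i. enc (view X n x i))" for x
    using surj_uminus image_image[of "\<lambda>i. enc (view X n x i)" uminus UNIV] by metis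
  ultimately have "right_instantaneous (\<Union>x\<in>X. range (\<lambda>i. enc (view X n x i)))
      (reflection ` (\<lambda>x i. enc (view X n x i)) ` X)"
    by (simp add: image_image reflection_def)
  with right_instantaneous_views[OF inj] left_instantaneous_reflection show ?thesis
    unfolding bi_instantaneous_def by blast
qed

section \<open>Safe positions in sofic systems\<close>

definition paths :: "(nat \<times> 'a \<times> nat) set \<Rightarrow> (int \<Rightarrow> 'a) \<Rightarrow> int \<Rightarrow> int \<Rightarrow> (nat \<times> nat) set" where
  "paths E x i j = {(v i, v (j + 1)) | v. \<forall>k\<in>{i..j}. (v k, x k, v (k + 1)) \<in> E}"

text \<open>The point \<open>y\<close> with the word \<open>x\<^sub>c\<^sub>+\<^sub>1 \<dots> x\<^sub>c\<^sub>+\<^sub>q\<close> inserted after position \<open>c\<close>.\<close>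

definition insert_after :: "int \<Rightarrow> int \<Rightarrow> (int \<Rightarrow> 'a) \<Rightarrow> (int \<Rightarrow> 'a) \<Rightarrow> int \<Rightarrow> 'a" where
  "insert_after c q x y = (\<lambda>k. if k \<le> c then y k else if k \<le> c + q then x k else y (k - q))"

text \<open>If \<open>x\<^sub>i \<dots> x\<^sub>c\<close> and \<open>x\<^sub>i \<dots> x\<^sub>c\<^sub>+\<^sub>q\<close> connect the same pairs of vertices, a path for the longer
  word can replace the stretch of a path of \<open>y\<close> that reads the shorter one.\<close>

lemma insert_after_in_sofic:
  assumes X: "X = {x. \<exists>v. \<forall>i::int. (v i, x i, v (i + 1)) \<in> E}"
    and eq: "paths E x i c = paths E x i (c + q)" and "i \<le> c" "0 < q"
    and "y \<in> X" and y: "\<forall>k\<in>{i..c}. y k = x k"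
  shows "insert_after c q x y \<in> X"
proof -
  obtain v where v: "\<And>k. (v k, y k, v (k + 1)) \<in> E"
    using \<open>y \<in> X\<close> X by blast
  have "\<forall>k\<in>{i..c}. (v k, x k, v (k + 1)) \<in> E"
    using y v by metis
  then have "(v i, v (c + 1)) \<in> paths E x i c"
    unfolding paths_def by blast
  then have "(v i, v (c + 1)) \<in> paths E x i (c + q)"
    by (simp only: eq)
  then obtain w where w: "w i = v i" "w (c + q + 1) = v (c + 1)"
      "\<forall>k\<in>{i..c + q}. (w k, x k, w (k + 1)) \<in> E"
    unfolding paths_def by auto
  \<comment> \<open>\<open>u\<close> follows \<open>v\<close> up to \<open>i\<close>, then \<open>w\<close> through the lengthened word, then \<open>v\<close> again\<close>
  define u where "u k = (if k \<le> i then v k else if k \<le> c + q then w k else v (k - q))" for k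
  have "(u k, insert_after c q x y k, u (k + 1)) \<in> E" for k
  proof -
    consider "k < i" | "i \<le> k" "k < c + q" | "k = c + q" | "c + q < k" by linarith
    then show ?thesis
    proof cases
      case 1
      with v[of k] \<open>i \<le> c\<close> show ?thesis by (simp add: u_def insert_after_def)
    next
      case 2
      then have "u k = w k" "u (k + 1) = w (k + 1)"
        using w by (auto simp: u_def)
      moreover have "insert_after c q x y k = x k"
        using 2 y by (simp add: insert_after_def)
      ultimately show ?thesis using w(3) 2 by simp
    next
      case 3
      then have "u k = w k" "u (k + 1) = w (k + 1)"
        using w \<open>i \<le> c\<close> \<open>0 < q\<close> by (auto simp: u_def)
      moreover have "insert_after c q x y k = x k"
        using 3 \<open>0 < q\<close> by (simp add: insert_after_def)
      ultimately show ?thesis using w(3) 3 \<open>i \<le> c\<close> \<open>0 < q\<close> by simp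
    next
      case 4
      with v[of "k - q"] \<open>i \<le> c\<close> \<open>0 < q\<close> show ?thesis
        by (simp add: u_def insert_after_def algebra_simps)
    qed
  qed
  then show ?thesis using X by blast
qed

text \<open>After \<open>m\<close> insertions the \<open>m q\<close> letters following \<open>c\<close> are \<open>m\<close> copies of the inserted word, whatever
  point one started from.\<close>

lemma insert_after_iterate:
  assumes "0 < q" "c < k" "k \<le> c + int m * q"
  shows "(insert_after c q x ^^ m) y k = (insert_after c q x ^^ m) y' k"
  using assms
proof (induction m arbitrary: k)
  case (Suc m)
  show ?case
  proof (cases "k \<le> c + q")
    case True
    with Suc.prems show ?thesis by (simp add: insert_after_def)
  next
    case False
    with Suc.prems Suc.IH[of "k - q"] show ?thesis
      by (simp add: insert_after_def algebra_simps)
  qed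
qed simp

text \<open>The continuation consists of copies of the word \<open>x\<^sub>c\<^sub>+\<^sub>1 \<dots> x\<^sub>c\<^sub>+\<^sub>q\<close>. It is not empty, so \<open>n + 1\<close>
  insertions produce at least \<open>n + 1\<close> letters.\<close>

lemma right_safe_if_paths_eq:
  assumes X: "X = {x. \<exists>v. \<forall>i::int. (v i, x i, v (i + 1)) \<in> E}"
    and eq: "paths E x i c = paths E x i (c + q)" and "i \<le> c" "0 < q" "c \<le> i + int n"
  shows "right_safe X n x c"
  unfolding right_safe_def
proof (intro exI ballI impI)
  fix y assume y: "y \<in> X" "\<forall>k\<in>{c - int n..c}. y k = x k"
  define f where "f = insert_after c q x"
  have below: "(f ^^ m) y k = y k" if "k \<le> c" for m k
    using that by (induction m) (auto simp: f_def insert_after_def)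
  have "(f ^^ m) y \<in> X" for m
  proof (induction m)
    case (Suc m)
    have "\<forall>k\<in>{i..c}. (f ^^ m) y k = x k"
      using below y(2) \<open>c \<le> i + int n\<close> by auto
    with insert_after_in_sofic[OF X eq \<open>i \<le> c\<close> \<open>0 < q\<close> Suc.IH] show ?case
      by (simp add: f_def)
  qed (use y in simp)
  moreover have "(f ^^ Suc n) y k = (f ^^ Suc n) x k" if "k \<in> {c<..c + int n + 1}" for k
  proof -
    have "int (Suc n) * 1 \<le> int (Suc n) * q"
      using \<open>0 < q\<close> by (intro mult_left_mono) auto
    moreover have "int (Suc n) * 1 = int n + 1" "c < k" "k \<le> c + int n + 1"
      using that by simp_all
    ultimately have "c < k" "k \<le> c + int (Suc n) * q" by linarith+
    with \<open>0 < q\<close> show ?thesis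
      unfolding f_def by (rule insert_after_iterate)
  qed
  ultimately show "\<exists>y'\<in>X. (\<forall>k\<le>c. y' k = y k) \<and>
      (\<forall>k\<in>{c<..c + int n + 1}. y' k = (insert_after c q x ^^ Suc n) x k)"
    using below unfolding f_def by blast
qed

text \<open>Of the \<open>card (Pow (V \<times> V)) + 1\<close> words starting at \<open>i\<close>, two have the same transition
  relation.\<close>

lemma right_syndetic_sofic:
  fixes E :: "(nat \<times> 'a \<times> nat) set"
  assumes X: "X = {x. \<exists>v. \<forall>i::int. (v i, x i, v (i + 1)) \<in> E}"
    and V: "finite V" "fst ` E \<subseteq> V" "(snd \<circ> snd) ` E \<subseteq> V"
  shows "\<exists>c\<in>{i..i + int (card (Pow (V \<times> V)))}. right_safe X (card (Pow (V \<times> V))) x c"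
proof -
  let ?n = "card (Pow (V \<times> V))"
  have "paths E x i j \<subseteq> V \<times> V" if "i \<le> j" for j
  proof clarify
    fix p r assume "(p, r) \<in> paths E x i j"
    then obtain v where v: "p = v i" "r = v (j + 1)" "\<forall>k\<in>{i..j}. (v k, x k, v (k + 1)) \<in> E"
      unfolding paths_def by blast
    have "(v i, x i, v (i + 1)) \<in> E" "(v j, x j, v (j + 1)) \<in> E"
      using v(3) that by auto
    with V(2,3) v(1,2) show "p \<in> V \<and> r \<in> V" by force
  qed
  then have "paths E x i ` {i..i + int ?n} \<subseteq> Pow (V \<times> V)"
    by (intro image_subsetI PowI) simp
  then have "card (paths E x i ` {i..i + int ?n}) \<le> ?n"
    using V(1) by (intro card_mono) auto
  also have "\<dots> < card {i..i + int ?n}" by simp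
  finally have "\<not> inj_on (paths E x i) {i..i + int ?n}"
    by (rule pigeonhole)
  then obtain c d where cd: "c \<in> {i..i + int ?n}" "d \<in> {i..i + int ?n}" "c < d"
      "paths E x i c = paths E x i d"
    using linorder_inj_onI'[of "{i..i + int ?n}" "paths E x i"] by blast
  then have "right_safe X ?n x c"
    using right_safe_if_paths_eq[OF X, of x i c "d - c" ?n] by auto
  with cd(1) show ?thesis by blast
qed

lemma translate_subshift:
  assumes "shift ` X = X" "x \<in> X"
  shows "(\<lambda>i. x (i + k)) \<in> X"
proof (induction k rule: int_induct[where k = 0])
  case base
  show ?case using assms(2) by simp
next
  case (step1 k)
  then have "shift (\<lambda>i. x (i + k)) \<in> shift ` X" by (intro imageI)
  then have "shift (\<lambda>i. x (i + k)) \<in> X" by (simp only: assms(1))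
  then show ?case by (simp add: shift_def algebra_simps)
next
  case (step2 k)
  then have "(\<lambda>i. x (i + k)) \<in> shift ` X" by (simp only: assms(1))
  then obtain y where y: "y \<in> X" "(\<lambda>i. x (i + k)) = shift y" by (elim imageE)
  have "y i = x (i + (k - 1))" for i
    using fun_cong[OF y(2), of "i - 1"] by (simp add: shift_def algebra_simps)
  then have "y = (\<lambda>i. x (i + (k - 1)))" by (rule ext)
  with y(1) show ?case by simp
qed

lemma sofic_safely_syndetic:
  assumes "shift ` X = X" "sofic X"
  obtains n where "safely_syndetic X n"
proof -
  obtain E :: "(nat \<times> 'a \<times> nat) set" where E: "finite E"
    and X: "X = {x. \<exists>v. \<forall>i::int. (v i, x i, v (i + 1)) \<in> E}"
    using assms(2) unfolding sofic_def by blast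
  \<comment> \<open>reversing all edges presents the reflected system on the same vertices\<close>
  define E' where "E' = (\<lambda>(p, a, q). (q, a, p)) ` E"
  have E'_iff: "(p, a, q) \<in> E' \<longleftrightarrow> (q, a, p) \<in> E" for p a q
    by (force simp: E'_def)
  define V where "V = fst ` E \<union> (snd \<circ> snd) ` E"
  have V: "finite V" "fst ` E \<subseteq> V" "(snd \<circ> snd) ` E \<subseteq> V"
    "fst ` E' \<subseteq> V" "(snd \<circ> snd) ` E' \<subseteq> V"
    using E by (simp_all add: V_def E'_def image_Un image_image case_prod_unfold)
  have X': "reflection ` X = {x. \<exists>v. \<forall>i::int. (v i, x i, v (i + 1)) \<in> E'}"
  proof (intro equalityI subsetI)
    fix x assume "x \<in> reflection ` X"
    then obtain y v where y: "x = reflection y" "\<And>i. (v i, y i, v (i + 1)) \<in> E"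
      unfolding X by blast
    have "(v (1 - i), x i, v (1 - (i + 1))) \<in> E'" for i
      using y(2)[of "- i"] by (simp add: E'_iff y(1) reflection_def algebra_simps)
    then show "x \<in> {x. \<exists>v. \<forall>i::int. (v i, x i, v (i + 1)) \<in> E'}"
      by (intro CollectI exI[of _ "\<lambda>i. v (1 - i)"]) blast
  next
    fix x assume "x \<in> {x. \<exists>v. \<forall>i::int. (v i, x i, v (i + 1)) \<in> E'}"
    then obtain v where v: "\<And>i. (v (i + 1), x i, v i) \<in> E"
      unfolding E'_iff by blast
    have "(v (1 - i), reflection x i, v (1 - (i + 1))) \<in> E" for i
      using v[of "- i"] by (simp add: reflection_def algebra_simps)
    then have "reflection x \<in> X"
      unfolding X by (intro CollectI exI[of _ "\<lambda>i. v (1 - i)"]) blast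
    then show "x \<in> reflection ` X"
      by (metis imageI reflection_reflection)
  qed
  have "safely_syndetic X (card (Pow (V \<times> V)))"
  proof
    show "(\<lambda>i. x (i + k)) \<in> X" if "x \<in> X" for x k
      using translate_subshift[OF assms(1) that] .
  qed (use right_syndetic_sofic[OF X V(1-3)] right_syndetic_sofic[OF X' V(1,4,5)] in blast)+
  then show ?thesis by (rule that)
qed

section \<open>Injective sliding block codes are conjugacies\<close>

lemma openin_cylinder:
  assumes "finite F"
  shows "openin (full_shift A) {y \<in> topspace (full_shift A). \<forall>k\<in>F. y k = x k}"
proof -
  have "{y \<in> topspace (full_shift A). \<forall>k\<in>F. y k = x k} =
      (\<Pi>\<^sub>E k\<in>UNIV. if k \<in> F then A \<inter> {x k} else A)"
    by (auto simp: full_shift_def PiE_iff split: if_splits)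
  also have "openin (full_shift A) \<dots>"
    unfolding full_shift_def
  proof (rule product_topology_basis)
    have "{i. (if i \<in> F then A \<inter> {x i} else A) \<noteq> topspace (discrete_topology A)} \<subseteq> F" by auto
    then show "finite {i. (if i \<in> F then A \<inter> {x i} else A) \<noteq> topspace (discrete_topology A)}"
      using assms finite_subset by blast
  qed auto
  finally show ?thesis .
qed

lemma continuous_map_sliding_block:
  assumes "X \<subseteq> topspace (full_shift A)"
    and B: "\<And>x i. x \<in> X \<Longrightarrow> \<phi> x i \<in> B"
    and window: "\<And>x y i. x \<in> X \<Longrightarrow> y \<in> X \<Longrightarrow> \<forall>k\<in>{i - r..i + r}. y k = x k \<Longrightarrow> \<phi> y i = \<phi> x i"
  shows "continuous_map (subtopology (full_shift A) X) (full_shift B) \<phi>"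
  unfolding full_shift_def[of B] continuous_map_componentwise_UNIV
proof
  fix i
  let ?T = "subtopology (full_shift A) X"
  have top: "topspace ?T = X" using assms(1) by auto
  show "continuous_map ?T (discrete_topology B) (\<lambda>x. \<phi> x i)"
    unfolding continuous_map_def top
  proof (intro conjI allI impI)
    show "(\<lambda>x. \<phi> x i) \<in> X \<rightarrow> topspace (discrete_topology B)" using B by auto
    fix U
    show "openin ?T {x \<in> X. \<phi> x i \<in> U}"
    proof (subst openin_subopen, intro ballI)
      fix x assume x: "x \<in> {x \<in> X. \<phi> x i \<in> U}"
      let ?C = "{y \<in> topspace (full_shift A). \<forall>k\<in>{i - r..i + r}. y k = x k} \<inter> X"
      have "openin ?T ?C"
        by (intro openin_subtopology_Int openin_cylinder) simp
      moreover have "?C \<subseteq> {x \<in> X. \<phi> x i \<in> U}"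
      proof
        fix y assume "y \<in> ?C"
        with x window[of x y i] show "y \<in> {x \<in> X. \<phi> x i \<in> U}" by simp
      qed
      ultimately show "\<exists>T. openin ?T T \<and> x \<in> T \<and> T \<subseteq> {x \<in> X. \<phi> x i \<in> U}"
        using x assms(1) by (intro exI[of _ ?C]) auto
    qed
  qed
qed

text \<open>A continuous injection from a compact space into a Hausdorff space is a homeomorphism onto
  its closed image.\<close>

lemma conjugacy_of_injective_sliding_block:
  fixes \<phi> :: "(int \<Rightarrow> 'a) \<Rightarrow> int \<Rightarrow> 'b"
  assumes X: "subshift A X"
    and fin: "finite (\<Union>x\<in>X. range (\<phi> x))"
    and window: "\<And>x y i. x \<in> X \<Longrightarrow> y \<in> X \<Longrightarrow> \<forall>k\<in>{i - r..i + r}. y k = x k \<Longrightarrow> \<phi> y i = \<phi> x i"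
    and shift: "\<And>x. x \<in> X \<Longrightarrow> \<phi> (shift x) = shift (\<phi> x)"
    and inj: "inj_on \<phi> X"
  shows "subshift (\<Union>x\<in>X. range (\<phi> x)) (\<phi> ` X)"
    and "conjugacy A X (\<Union>x\<in>X. range (\<phi> x)) (\<phi> ` X) \<phi>"
proof -
  define B where "B = (\<Union>x\<in>X. range (\<phi> x))"
  let ?T = "subtopology (full_shift A) X"
  have closed: "closedin (full_shift A) X" and invariant: "shift ` X = X" and "finite A"
    using X by (simp_all add: subshift_def)
  have sub: "X \<subseteq> topspace (full_shift A)"
    using closed by (rule closedin_subset)
  then have top: "topspace ?T = X" by auto
  have "compact_space (full_shift A)"
    using \<open>finite A\<close>
    by (simp add: full_shift_def compact_space_product_topology compact_space_discrete_topology)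
  then have compact: "compact_space ?T"
    using closed by (simp add: closedin_compact_space compact_space_subtopology)
  have hausdorff: "Hausdorff_space (full_shift B)"
    by (simp add: full_shift_def Hausdorff_space_product_topology)
  have cont: "continuous_map ?T (full_shift B) \<phi>"
    by (rule continuous_map_sliding_block[OF sub _ window]) (auto simp: B_def)
  have "compactin (full_shift B) (\<phi> ` X)"
    using image_compactin[OF _ cont, of X] compact top by (simp add: compact_space_def)
  then have closedY: "closedin (full_shift B) (\<phi> ` X)"
    by (rule compactin_imp_closedin[OF hausdorff])
  have "shift ` \<phi> ` X = \<phi> ` shift ` X"
    using shift by (simp add: image_image)
  then show "subshift (\<Union>x\<in>X. range (\<phi> x)) (\<phi> ` X)"
    using fin closedY invariant by (simp add: subshift_def B_def)
  have "homeomorphic_map ?T (subtopology (full_shift B) (\<phi> ` X)) \<phi>"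
  proof (rule continuous_imp_homeomorphic_map)
    show "continuous_map ?T (subtopology (full_shift B) (\<phi> ` X)) \<phi>"
      using cont top by (simp add: continuous_map_in_subtopology)
    show "Hausdorff_space (subtopology (full_shift B) (\<phi> ` X))"
      using hausdorff by (rule Hausdorff_space_subtopology)
    show "\<phi> ` topspace ?T = topspace (subtopology (full_shift B) (\<phi> ` X))"
      using closedin_subset[OF closedY] top by auto
  qed (use compact inj top in auto)
  then show "conjugacy A X (\<Union>x\<in>X. range (\<phi> x)) (\<phi> ` X) \<phi>"
    using shift by (simp add: conjugacy_def B_def)
qed

theorem theorem6p1:
  fixes A :: "'a set" and X :: "(int \<Rightarrow> 'a) set"
  assumes "subshift A X" and "sofic X"
  shows "\<exists>(B :: nat set) (Y :: (int \<Rightarrow> nat) set).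
    subshift B Y \<and> topologically_conjugate A X B Y \<and> bi_instantaneous B Y"
proof -
  have A: "finite A" "shift ` X = X" "\<And>x i. x \<in> X \<Longrightarrow> x i \<in> A"
    using assms(1) by (auto simp: subshift_def)
  obtain n where "safely_syndetic X n"
    using sofic_safely_syndetic[OF A(2) assms(2)] .
  then interpret safely_syndetic X n .
  let ?V = "{view X n x i | x i. x \<in> X}"
  have fin: "finite ?V"
    using A(1,3) by (rule finite_views)
  obtain enc :: "(int \<Rightarrow> 'a option) \<Rightarrow> nat" where enc: "inj_on enc ?V"
    using finite_imp_inj_to_nat_seg[OF fin] by (elim exE conjE)
  define \<phi> where "\<phi> = (\<lambda>x i. enc (view X n x i))"
  define B where "B = (\<Union>x\<in>X. range (\<phi> x))"
  have "B \<subseteq> enc ` ?V" by (auto simp: B_def \<phi>_def)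
  then have "finite B" using fin finite_surj by blast
  have window: "\<phi> y i = \<phi> x i"
    if "x \<in> X" "y \<in> X" "\<forall>k\<in>{i - 2 * int n..i + 2 * int n}. y k = x k" for x y i
    using that left_end_bounds(2)[OF that(1), of i] right_end_safe(3)[OF that(1), of i]
    by (auto simp: \<phi>_def intro!: arg_cong[of _ _ enc] view_cong)
  have shift: "\<phi> (shift x) = shift (\<phi> x)" for x
    by (simp add: \<phi>_def shift_def view_translate)
  have inj: "inj_on \<phi> X"
  proof (rule inj_onI, rule ext)
    fix x y i assume xy: "x \<in> X" "y \<in> X" "\<phi> x = \<phi> y"
    have "view X n x i = view X n y i"
      using xy(1,2) fun_cong[OF xy(3), of i] by (intro inj_onD[OF enc]) (auto simp: \<phi>_def)
    with view_0[OF xy(1), of i] view_0[OF xy(2), of i] show "x i = y i" by simp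
  qed
  have "subshift B (\<phi> ` X)" "conjugacy A X B (\<phi> ` X) \<phi>"
    using conjugacy_of_injective_sliding_block[OF assms(1) _ window shift inj] \<open>finite B\<close>
    unfolding B_def by blast+
  moreover have "bi_instantaneous B (\<phi> ` X)"
    using bi_instantaneous_views[OF enc] by (simp add: B_def \<phi>_def)
  ultimately show ?thesis
    unfolding topologically_conjugate_def by blast
qed

end
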